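(* Let $d \ge 1$ be an integer and let $G$ be a graph with $n \ge 5$ nodes and node weights $\mathbf{w}_j = (w^1_j,\ldots,w^d_j) \in \mathbb{R}^d$, $j = 1,\ldots,n$ (and no edge weights). Suppose that, for every pairwise distinct $i,j,k \in \{1,\ldots,n\}$ and every pairwise distinct $m,p,q,r \in \{1,\ldots,n\}$, we have $$w^l_i + w^l_j + w^{l+1}_j + w^{l+1}_k \ne w^l_m + w^l_p + w^{l+1}_q + w^{l+1}_r \quad \text{for all } l = 1,\ldots,d-1.$$ Then $G$ is reconstructible from the following $2d-1$ distributions: $\mathcal{D}_{w^l}(G)$ for $l=1,\ldots,d$, and $\mathcal{D}_{\beta^{l,l+1}}(G)$ for $l = 1,\ldots,d-1$. That is, every graph $G'$ with $n$ nodes and node weights in $\mathbb{R}^d$ (and no edge weights) for which each of these $2d-1$ distributions coincides with the corresponding one for $G$ is isomorphic to $G$.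
   Context: Here a graph $G$ with $n$ nodes and node weights in $\mathbb{R}^d$ (no edge weights) is an assignment of a vector $\mathbf{w}_j = (w^1_j,\ldots,w^d_j) \in \mathbb{R}^d$ to each $j \in \{1,\ldots,n\}$. Two such graphs with node weights $\mathbf{w}_j$ and $\mathbf{w}'_j$ are isomorphic if there is a permutation $\pi \in S_n$ with $\mathbf{w}'_j = \mathbf{w}_{\pi(j)}$ for all $j$. A distribution means a multiset, i.e. a set with a positive integer multiplicity for each element. $\mathcal{D}_{w^l}(G)$ is the multiset of all $w^l_i$, $i = 1,\ldots,n$. For pairwise distinct $i,j,k$ and $l \in \{1,\ldots,d-1\}$ put $$\beta^{l,l+1}_{i,j,k} = w^l_i + w^l_j + w^{l+1}_j + w^{l+1}_k.$$ $\mathcal{D}_{\beta^{l,l+1}}(G)$ is the multiset of all $\beta^{l,l+1}_{i,j,k}$ taken over all pairwise distinct $i,j,k \in \{1,\ldots,n\}$. *)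

theory Defs
  imports Complex_Main "HOL-Library.Multiset" "HOL-Combinatorics.Permutations"
begin

text \<open>A graph with \<open>n\<close> nodes and node weights in \<open>\<real>\<^sup>d\<close> (no edge weights) is a function \<open>w\<close>, where
  \<open>w j l\<close> is the \<open>l\<close>-th coordinate of the weight vector of node \<open>j\<close>.  Only the values at
  \<open>1 \<le> j \<le> n\<close> and \<open>1 \<le> l \<le> d\<close> carry information, and the definitions below inspect no others.\<close>

type_synonym node_weighted_graph = "nat \<Rightarrow> nat \<Rightarrow> real"

definition isomorphic_graphs ::
  "nat \<Rightarrow> nat \<Rightarrow> node_weighted_graph \<Rightarrow> node_weighted_graph \<Rightarrow> bool" where
  "isomorphic_graphs n d w w' \<longleftrightarrow>
     (\<exists>\<pi>. \<pi> permutes {1..n} \<and> (\<forall>j\<in>{1..n}. \<forall>l\<in>{1..d}. w' j l = w (\<pi> j) l))"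

definition weight_distribution :: "nat \<Rightarrow> nat \<Rightarrow> node_weighted_graph \<Rightarrow> real multiset" where
  "weight_distribution n l w = image_mset (\<lambda>i. w i l) (mset_set {1..n})"

definition beta :: "nat \<Rightarrow> node_weighted_graph \<Rightarrow> nat \<Rightarrow> nat \<Rightarrow> nat \<Rightarrow> real" where
  "beta l w i j k = w i l + w j l + w j (l + 1) + w k (l + 1)"

definition distinct_triples :: "nat \<Rightarrow> (nat \<times> nat \<times> nat) set" where
  "distinct_triples n = {(i, j, k) \<in> {1..n} \<times> {1..n} \<times> {1..n}. distinct [i, j, k]}"

text \<open>\<^const>\<open>mset_set\<close> of an infinite set would be the empty multiset; here this cannot occur.\<close>

lemma finite_distinct_triples: "finite (distinct_triples n)"
  unfolding distinct_triples_def
  by (rule finite_subset[of _ "{1..n} \<times> {1..n} \<times> {1..n}"]) auto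

definition beta_distribution :: "nat \<Rightarrow> nat \<Rightarrow> node_weighted_graph \<Rightarrow> real multiset" where
  "beta_distribution n l w =
     image_mset (\<lambda>(i, j, k). beta l w i j k) (mset_set (distinct_triples n))"

end

theory Submission
  imports Defs
begin

text \<open>Equality of the distributions of a single coordinate \<open>l\<close> says that coordinate \<open>l\<close> of \<open>w'\<close> is
  coordinate \<open>l\<close> of \<open>w\<close> after some permutation \<open>\<sigma>\<^sub>l\<close> of the nodes.  The graphs are isomorphic as soon
  as one permutation serves for all coordinates, so it is enough that \<open>\<sigma>\<^sub>l = \<sigma>\<^sub>l\<^sub>+\<^sub>1\<close> for every \<open>l\<close>.

  Write \<open>\<sigma> = \<sigma>\<^sub>l\<close> and \<open>\<tau> = \<sigma>\<^sub>l\<^sub>+\<^sub>1\<close>.  In terms of \<open>w\<close>, the value of \<open>\<beta>\<close> for \<open>w'\<close> at \<open>(i, j, k)\<close> is the sum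
  of coordinate \<open>l\<close> at the nodes \<open>\<sigma> i\<close>, \<open>\<sigma> j\<close> and of coordinate \<open>l + 1\<close> at the nodes \<open>\<tau> j\<close>, \<open>\<tau> k\<close>.  As
  it occurs among the values of \<open>\<beta>\<close> for \<open>w\<close>, the genericity hypothesis forbids these four nodes to be
  distinct.  But if \<open>\<sigma> j \<noteq> \<tau> j\<close>, then \<open>i\<close> and afterwards \<open>k\<close> can be chosen to make them distinct:
  only two values of \<open>i\<close> and four values of \<open>k\<close> are excluded, and there are at least five
  nodes (\<open>disagreeing_permutations_separate_a_triple\<close>).  Hence \<open>\<sigma> = \<tau>\<close>
  (\<open>consecutive_permutations_agree\<close>).\<close>

lemma ex_in_outside_finite_set:
  assumes "finite B" and "card B < card A"
  shows "\<exists>x\<in>A. x \<notin> B"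
  using assms by (meson card_mono leD subsetI)

text \<open>The index \<open>i\<close> has to avoid \<open>j\<close> and the preimage of \<open>\<tau> j\<close> under \<open>\<sigma>\<close>; the index \<open>k\<close> has to avoid
  \<open>i\<close>, \<open>j\<close> and the preimages of \<open>\<sigma> i\<close>, \<open>\<sigma> j\<close> under \<open>\<tau>\<close>.  The remaining inequalities come from the
  injectivity of \<open>\<sigma>\<close> and \<open>\<tau>\<close>.\<close>

lemma disagreeing_permutations_separate_a_triple:
  assumes \<sigma>: "\<sigma> permutes A" and \<tau>: "\<tau> permutes A" and card: "card A \<ge> 5"
    and j: "j \<in> A" and neq: "\<sigma> j \<noteq> \<tau> j"
  shows "\<exists>i k. {i, j, k} \<subseteq> A \<and> distinct [i, j, k] \<and> distinct [\<sigma> i, \<sigma> j, \<tau> j, \<tau> k]"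
proof -
  have "card {j, inv \<sigma> (\<tau> j)} < card A"
    using card card_length[of "[j, inv \<sigma> (\<tau> j)]"] by simp
  then obtain i where i: "i \<in> A" "i \<noteq> j" "i \<noteq> inv \<sigma> (\<tau> j)"
    using ex_in_outside_finite_set[of "{j, inv \<sigma> (\<tau> j)}" A] by auto
  have "card {i, j, inv \<tau> (\<sigma> i), inv \<tau> (\<sigma> j)} < card A"
    using card card_length[of "[i, j, inv \<tau> (\<sigma> i), inv \<tau> (\<sigma> j)]"] by simp
  then obtain k where k: "k \<in> A" "k \<noteq> i" "k \<noteq> j" "k \<noteq> inv \<tau> (\<sigma> i)" "k \<noteq> inv \<tau> (\<sigma> j)"
    using ex_in_outside_finite_set[of "{i, j, inv \<tau> (\<sigma> i), inv \<tau> (\<sigma> j)}" A] by auto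
  have "\<sigma> i \<noteq> \<sigma> j" "\<tau> j \<noteq> \<tau> k"
    using i k permutes_inj[OF \<sigma>] permutes_inj[OF \<tau>] by (auto dest: injD)
  moreover have "\<sigma> i \<noteq> \<tau> j" "\<sigma> i \<noteq> \<tau> k" "\<sigma> j \<noteq> \<tau> k"
    using i(3) k(4,5) permutes_inverses(2)[OF \<sigma>] permutes_inverses(2)[OF \<tau>] by metis+
  ultimately show ?thesis
    using i k j neq by (intro exI[of _ i] exI[of _ k]) auto
qed

lemma set_mset_beta_distribution:
  "set_mset (beta_distribution n l w) =
     {beta l w i j k |i j k. {i, j, k} \<subseteq> {1..n} \<and> distinct [i, j, k]}"
proof -
  have "set_mset (beta_distribution n l w) = (\<lambda>(i, j, k). beta l w i j k) ` distinct_triples n"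
    by (simp add: beta_distribution_def finite_distinct_triples)
  also have "\<dots> = {beta l w i j k |i j k. (i, j, k) \<in> distinct_triples n}"
    unfolding image_def Bex_def split_paired_Ex prod.case by blast
  also have "\<dots> = {beta l w i j k |i j k. {i, j, k} \<subseteq> {1..n} \<and> distinct [i, j, k]}"
    unfolding distinct_triples_def by simp
  finally show ?thesis .
qed

text \<open>A node \<open>j\<close> on which the two permutations disagree would make some value of \<open>\<beta>\<close> for \<open>w'\<close> a sum of
  weights of \<open>w\<close> at four distinct nodes; such a sum is never a value of \<open>\<beta>\<close> for \<open>w\<close>.\<close>

lemma consecutive_permutations_agree:
  fixes w w' :: node_weighted_graph
  assumes "n \<ge> 5"
    and generic: "\<And>i j k m p q r.
      \<lbrakk>{i, j, k} \<subseteq> {1..n}; distinct [i, j, k]; {m, p, q, r} \<subseteq> {1..n}; distinct [m, p, q, r]\<rbrakk>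
      \<Longrightarrow> beta l w i j k \<noteq> w m l + w p l + w q (l + 1) + w r (l + 1)"
    and beta: "set_mset (beta_distribution n l w') \<subseteq> set_mset (beta_distribution n l w)"
    and \<sigma>: "\<sigma> permutes {1..n}" "\<And>j. j \<in> {1..n} \<Longrightarrow> w' j l = w (\<sigma> j) l"
    and \<tau>: "\<tau> permutes {1..n}" "\<And>j. j \<in> {1..n} \<Longrightarrow> w' j (l + 1) = w (\<tau> j) (l + 1)"
    and j: "j \<in> {1..n}"
  shows "\<sigma> j = \<tau> j"
proof (rule ccontr)
  assume "\<sigma> j \<noteq> \<tau> j"
  then obtain i k where ik: "{i, j, k} \<subseteq> {1..n}" "distinct [i, j, k]"
    and sep: "distinct [\<sigma> i, \<sigma> j, \<tau> j, \<tau> k]"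
    using disagreeing_permutations_separate_a_triple[OF \<sigma>(1) \<tau>(1) _ j] \<open>n \<ge> 5\<close> by auto
  have "beta l w' i j k \<in> set_mset (beta_distribution n l w)"
    using beta ik unfolding set_mset_beta_distribution by blast
  then obtain a b c where abc: "{a, b, c} \<subseteq> {1..n}" "distinct [a, b, c]"
    and eq: "beta l w' i j k = beta l w a b c"
    unfolding set_mset_beta_distribution by blast
  have "beta l w' i j k = w (\<sigma> i) l + w (\<sigma> j) l + w (\<tau> j) (l + 1) + w (\<tau> k) (l + 1)"
    using ik(1) \<sigma>(2) \<tau>(2) by (simp add: beta_def)
  moreover have "{\<sigma> i, \<sigma> j, \<tau> j, \<tau> k} \<subseteq> {1..n}"
    using ik(1) permutes_in_image[OF \<sigma>(1)] permutes_in_image[OF \<tau>(1)] by blast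
  ultimately show False
    using generic[OF abc _ sep] eq by simp
qed

theorem theorem3p6:
  fixes d n :: nat and w :: node_weighted_graph
  assumes "d \<ge> 1" and "n \<ge> 5"
    and "\<And>i j k m p q r l.
      \<lbrakk>{i, j, k} \<subseteq> {1..n}; distinct [i, j, k];
       {m, p, q, r} \<subseteq> {1..n}; distinct [m, p, q, r]; l \<in> {1..<d}\<rbrakk>
      \<Longrightarrow> w i l + w j l + w j (l + 1) + w k (l + 1) \<noteq> w m l + w p l + w q (l + 1) + w r (l + 1)"
  shows "\<forall>w' :: node_weighted_graph.
      (\<forall>l\<in>{1..d}. weight_distribution n l w' = weight_distribution n l w) \<and>
      (\<forall>l\<in>{1..<d}. beta_distribution n l w' = beta_distribution n l w)
      \<longrightarrow> isomorphic_graphs n d w w'"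
proof (intro allI impI)
  fix w' :: node_weighted_graph
  assume dists: "(\<forall>l\<in>{1..d}. weight_distribution n l w' = weight_distribution n l w) \<and>
      (\<forall>l\<in>{1..<d}. beta_distribution n l w' = beta_distribution n l w)"
  have "\<exists>p. p permutes {1..n} \<and> (\<forall>j\<in>{1..n}. w' j l = w (p j) l)" if "l \<in> {1..d}" for l
  proof -
    have "image_mset (\<lambda>i. w' i l) (mset_set {1..n}) = image_mset (\<lambda>i. w i l) (mset_set {1..n})"
      using dists that by (simp add: weight_distribution_def)
    from image_mset_eq_implies_permutes[OF finite_atLeastAtMost this] show ?thesis
      by blast
  qed
  then obtain \<sigma> where perm: "\<And>l. l \<in> {1..d} \<Longrightarrow> \<sigma> l permutes {1..n}"
    and coord: "\<And>l j. \<lbrakk>l \<in> {1..d}; j \<in> {1..n}\<rbrakk> \<Longrightarrow> w' j l = w (\<sigma> l j) l"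
    by metis
  have consecutive: "\<sigma> l j = \<sigma> (Suc l) j" if l: "l \<in> {1..<d}" and j: "j \<in> {1..n}" for l j
  proof (rule consecutive_permutations_agree[OF \<open>n \<ge> 5\<close>, where w = w and w' = w' and l = l
      and \<sigma> = "\<sigma> l" and \<tau> = "\<sigma> (Suc l)"])
    show "set_mset (beta_distribution n l w') \<subseteq> set_mset (beta_distribution n l w)"
      using dists l by simp
    show "beta l w i j k \<noteq> w m l + w p l + w q (l + 1) + w r (l + 1)"
      if "{i, j, k} \<subseteq> {1..n}" "distinct [i, j, k]" "{m, p, q, r} \<subseteq> {1..n}" "distinct [m, p, q, r]"
      for i j k m p q r
      using assms(3)[OF that l] unfolding beta_def .
    show "w' x (l + 1) = w (\<sigma> (Suc l) x) (l + 1)" if "x \<in> {1..n}" for x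
      using coord[of "Suc l" x] l that by simp
  qed (use l j perm coord in simp_all)
  have agree: "\<sigma> l j = \<sigma> 1 j" if "l \<in> {1..d}" and j: "j \<in> {1..n}" for l j
  proof -
    have "1 \<le> l" "l \<le> d" using that by auto
    then show ?thesis
    proof (induction l rule: dec_induct)
      case (step m)
      then show ?case using consecutive[of m j] j by simp
    qed simp
  qed
  show "isomorphic_graphs n d w w'"
    unfolding isomorphic_graphs_def
  proof (intro exI[of _ "\<sigma> 1"] conjI ballI)
    show "\<sigma> 1 permutes {1..n}" using perm \<open>d \<ge> 1\<close> by simp
    show "w' j l = w (\<sigma> 1 j) l" if "j \<in> {1..n}" "l \<in> {1..d}" for j l
      using coord[OF that(2,1)] agree[OF that(2,1)] by simp
  qed
qed

end
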